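(* For every $m\ge 1$ and every instance of problem FM with $m$ machines and $k=3$ ranks (i.e. $n=3m$ jobs, after padding with zero-length jobs), every LD schedule satisfies $t_{LD}\le \frac{5m-2}{4m-1}\,t^*$; that is, the Coffman–Sethi conjecture holds for $k=3$.
   Context: Problem FM: there are $m\ge 1$ identical parallel machines and $n=mk$ jobs ($k\ge 1$ is the number of ranks; an instance with fewer jobs is padded with jobs of processing time $0$), with nonnegative real processing times indexed so that $p_1\ge p_2\ge\cdots\ge p_n$. For $r\in\{1,\dots,k\}$, rank $r$ is the set of jobs $(r-1)m+1,\dots,rm$. A flowtime-optimal schedule assigns to every machine exactly one job from each rank and processes the jobs on each machine consecutively from time $0$ without idle time, in the order rank $k$, rank $k-1$, \dots, rank $1$; its makespan is the largest machine completion time. $t^*$ denotes the minimum makespan over all flowtime-optimal schedules. LD algorithm: ranks are handled in the order $1,2,\dots,k$; when handling a rank, the largest job of that rank is assigned to a machine of smallest current load (sum of processing times of jobs already assigned), the second largest to a machine of second smallest load, \dots, the smallest to a machine of largest load (ties broken arbitrarily); at the end the order of jobs on each machine is reversed, yielding a flowtime-optimal schedule. Any schedule obtainable this way is an LD schedule, and $t_{LD}$ denotes its makespan. The Coffman–Sethi conjecture asserts that for every $m$, every instance on $m$ machines and every LD schedule of it, $t_{LD}\le\frac{5m-2}{4m-1}t^*$. *)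

theory Defs
  imports Complex_Main "HOL-Library.FuncSet"
begin

definition fm_rank :: "nat \<Rightarrow> nat \<Rightarrow> nat set" where
  "fm_rank m r = {(r - 1) * m + 1..r * m}"

definition fm_instance :: "nat \<Rightarrow> nat \<Rightarrow> (nat \<Rightarrow> real) \<Rightarrow> bool" where
  "fm_instance m k p \<longleftrightarrow> 1 \<le> m \<and> 1 \<le> k \<and>
     (\<forall>j\<in>{1..m * k}. 0 \<le> p j) \<and> antimono_on {1..m * k} p"

text \<open>A schedule is given by the map sending each job to its machine; such maps are extensional,
  so that each schedule is represented only once. The processing order on a machine
  is determined by the ranks and enters through \<open>fm_completion\<close>.\<close>

definition flowtime_optimal :: "nat \<Rightarrow> nat \<Rightarrow> (nat \<Rightarrow> nat) \<Rightarrow> bool" where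
  "flowtime_optimal m k a \<longleftrightarrow> a \<in> {1..m * k} \<rightarrow>\<^sub>E {1..m} \<and>
     (\<forall>i\<in>{1..m}. \<forall>r\<in>{1..k}. \<exists>!j. j \<in> fm_rank m r \<and> a j = i)"

text \<open>Completion time of the rank \<open>r\<close> job on machine \<open>i\<close>: the machine processes its jobs of
  ranks \<open>k, k - 1, \<dots>, r\<close> consecutively from time 0.\<close>

definition fm_completion ::
    "nat \<Rightarrow> nat \<Rightarrow> (nat \<Rightarrow> real) \<Rightarrow> (nat \<Rightarrow> nat) \<Rightarrow> nat \<Rightarrow> nat \<Rightarrow> real" where
  "fm_completion m k p a i r = (\<Sum>s\<in>{r..k}. \<Sum>j\<in>{j \<in> fm_rank m s. a j = i}. p j)"

definition machine_completion ::
    "nat \<Rightarrow> nat \<Rightarrow> (nat \<Rightarrow> real) \<Rightarrow> (nat \<Rightarrow> nat) \<Rightarrow> nat \<Rightarrow> real" where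
  "machine_completion m k p a i = Max (fm_completion m k p a i ` {1..k})"

definition makespan :: "nat \<Rightarrow> nat \<Rightarrow> (nat \<Rightarrow> real) \<Rightarrow> (nat \<Rightarrow> nat) \<Rightarrow> real" where
  "makespan m k p a = Max (machine_completion m k p a ` {1..m})"

definition t_star :: "nat \<Rightarrow> nat \<Rightarrow> (nat \<Rightarrow> real) \<Rightarrow> real" where
  "t_star m k p = Min (makespan m k p ` {a. flowtime_optimal m k a})"

text \<open>Load of machine \<open>i\<close> once ranks \<open>1, \<dots>, r\<close> have been assigned.\<close>

definition fm_load ::
    "nat \<Rightarrow> (nat \<Rightarrow> real) \<Rightarrow> (nat \<Rightarrow> nat) \<Rightarrow> nat \<Rightarrow> nat \<Rightarrow> real" where
  "fm_load m p a r i = (\<Sum>j\<in>{j \<in> {1..r * m}. a j = i}. p j)"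

text \<open>When rank \<open>r\<close> is handled, \<open>\<tau>\<close> lists its jobs by nonincreasing processing time and \<open>\<sigma>\<close>
  lists the machines by nondecreasing current load; the existential choice of both covers
  every way of breaking ties.\<close>

definition LD_schedule :: "nat \<Rightarrow> nat \<Rightarrow> (nat \<Rightarrow> real) \<Rightarrow> (nat \<Rightarrow> nat) \<Rightarrow> bool" where
  "LD_schedule m k p a \<longleftrightarrow> a \<in> {1..m * k} \<rightarrow>\<^sub>E {1..m} \<and>
     (\<forall>r\<in>{1..k}. \<exists>\<tau> \<sigma>.
        bij_betw \<tau> {1..m} (fm_rank m r) \<and> antimono_on {1..m} (\<lambda>l. p (\<tau> l)) \<and>
        bij_betw \<sigma> {1..m} {1..m} \<and> mono_on {1..m} (\<lambda>l. fm_load m p a (r - 1) (\<sigma> l)) \<and>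
        (\<forall>l\<in>{1..m}. a (\<tau> l) = \<sigma> l))"

lemma LD_schedule_flowtime_optimal:
  assumes "LD_schedule m k p a"
  shows "flowtime_optimal m k a"
  unfolding flowtime_optimal_def
proof (intro conjI ballI)
  show "a \<in> {1..m * k} \<rightarrow>\<^sub>E {1..m}"
    using assms by (simp add: LD_schedule_def)
  fix i r assume i: "i \<in> {1..m}" and r: "r \<in> {1..k}"
  then obtain \<tau> \<sigma> where \<tau>: "bij_betw \<tau> {1..m} (fm_rank m r)"
    and \<sigma>: "bij_betw \<sigma> {1..m} {1..m}" and a: "\<forall>l\<in>{1..m}. a (\<tau> l) = \<sigma> l"
    using assms unfolding LD_schedule_def by blast
  obtain l where l: "l \<in> {1..m}" "\<sigma> l = i"
    using \<sigma> i unfolding bij_betw_def by (metis imageE)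
  show "\<exists>!j. j \<in> fm_rank m r \<and> a j = i"
  proof (rule ex1I[of _ "\<tau> l"])
    show "\<tau> l \<in> fm_rank m r \<and> a (\<tau> l) = i"
      using \<tau> l a bij_betwE by fastforce
    fix j assume j: "j \<in> fm_rank m r \<and> a j = i"
    then obtain l' where l': "l' \<in> {1..m}" "\<tau> l' = j"
      using \<tau> unfolding bij_betw_def by (metis imageE)
    then have "\<sigma> l' = \<sigma> l" using a j l by auto
    then have "l' = l" using \<sigma> l l' unfolding bij_betw_def inj_on_def by blast
    then show "j = \<tau> l" using l' by simp
  qed
qed

lemma finite_flowtime_optimal: "finite {a. flowtime_optimal m k a}"
  by (rule finite_subset[of _ "{1..m * k} \<rightarrow>\<^sub>E {1..m}"])
     (auto simp: flowtime_optimal_def intro: finite_PiE)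

lemma ex_flowtime_optimal: "\<exists>a. flowtime_optimal m k a"
proof -
  define a where "a = restrict (\<lambda>j. (j - 1) mod m + 1) {1..m * k}"
  have "\<exists>!j. j \<in> fm_rank m r \<and> a j = i" if i: "i \<in> {1..m}" and r: "r \<in> {1..k}" for i r
  proof -
    obtain q where q: "r = Suc q" using r by (cases r) auto
    have sub: "fm_rank m r \<subseteq> {1..m * k}"
      using r mult_le_mono2[of r k m] by (auto simp: fm_rank_def mult.commute)
    show ?thesis
    proof (rule ex1I[of _ "q * m + i"])
      have "q * m + i \<in> fm_rank m r" using i q by (auto simp: fm_rank_def)
      moreover have "(q * m + i - 1) mod m + 1 = i"
      proof -
        have "q * m + i - 1 = (i - 1) + q * m" using i by auto
        then have "(q * m + i - 1) mod m = (i - 1) mod m" by (simp only: mod_mult_self1)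
        also have "\<dots> = i - 1" using i by (intro mod_less) auto
        finally show ?thesis using i by simp
      qed
      ultimately show "q * m + i \<in> fm_rank m r \<and> a (q * m + i) = i"
        using sub by (auto simp: a_def)
      fix j assume j: "j \<in> fm_rank m r \<and> a j = i"
      then have "j \<in> {q * m + 1..q * m + m}" using q by (auto simp: fm_rank_def)
      then obtain d where d: "j = q * m + 1 + d" "d < m"
        by (intro that[of "j - (q * m + 1)"]) auto
      then have "a j = d + 1" using j sub by (auto simp: a_def)
      then show "j = q * m + i" using d j by auto
    qed
  qed
  moreover have "a \<in> {1..m * k} \<rightarrow>\<^sub>E {1..m}"
  proof (cases "m = 0")
    case False
    then show ?thesis by (auto simp: a_def Suc_le_eq)
  qed (auto simp: a_def)
  ultimately show ?thesis unfolding flowtime_optimal_def by blast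
qed

lemma t_star_attained:
  "\<exists>a. flowtime_optimal m k a \<and> t_star m k p = makespan m k p a"
proof -
  have "t_star m k p \<in> makespan m k p ` {a. flowtime_optimal m k a}"
    unfolding t_star_def using finite_flowtime_optimal ex_flowtime_optimal by (intro Min_in) auto
  then show ?thesis by auto
qed

lemma t_star_le: "flowtime_optimal m k a \<Longrightarrow> t_star m k p \<le> makespan m k p a"
  unfolding t_star_def using finite_flowtime_optimal by (intro Min_le) auto

end

theory Submission imports Defs begin

text \<open>
  Consider a machine of the LD schedule whose load after two ranks is \<open>L\<close> and whose rank 3 job
  has length \<open>z\<close>, and put \<open>T = t\<^sup>*\<close>, \<open>e = L + z - T\<close> and \<open>d = T - L\<close>. Let \<open>H\<close> be the machines with
  LD load at least \<open>L\<close> after two ranks, and \<open>Q\<close> those whose rank 3 job in an optimal schedule is at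
  least \<open>z\<close>, both indexed by their rank 1 job. By the LD rule \<open>|H| + |Q| > m\<close>.

  A common element of \<open>H\<close> and \<open>Q\<close> has rank 2 jobs in the two schedules that differ by at least
  \<open>e\<close>; as jobs of higher rank are shorter this gives \<open>T \<ge> 3z + e = 4e + 3d\<close>.

  Moreover \<open>e \<le> (m - 1) d\<close>. Otherwise cut \<open>H\<close> into groups separated by gaps larger than
  \<open>d\<close> between rank 1 job lengths. Within a group these lengths vary by less than \<open>e\<close>, so a pigeonhole
  count shows that at least as many optimal machines as the group has members have load
  above \<open>L - e = T - z\<close> after two ranks, hence lie outside \<open>Q\<close>, and their rank 1 jobs are
  no shorter than the shortest of the group and exceed its longest by at most \<open>d\<close>. Different groups yield different machines, contradicting \<open>|H| > m - |Q|\<close>.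

  Both bounds together give \<open>(4m - 1) e \<le> (m - 1) T\<close>, which is the claim.
\<close>

section \<open>Counting machines via monotone sequences and a permutation\<close>

text \<open>A step larger than \<open>d\<close> between consecutive members of \<open>H\<close> is a
  place to cut; if there is none, telescoping over the \<open>card H - 1\<close> steps bounds the
  range. The induction adds the largest member, so only one new step is examined.\<close>

lemma split_or_bounded_range:
  fixes A :: "nat \<Rightarrow> real" and H :: "nat set"
  assumes "finite H" "H \<noteq> {}" "0 \<le> d" "mono_on H A"
  shows "(\<exists>c. {i \<in> H. i < c} \<noteq> {} \<and> {i \<in> H. c \<le> i} \<noteq> {} \<and>
            (\<forall>i\<in>H. \<forall>j\<in>H. i < c \<longrightarrow> c \<le> j \<longrightarrow> A i + d < A j))
         \<or> A (Max H) - A (Min H) \<le> (real (card H) - 1) * d"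
  using assms
proof (induction H rule: finite_linorder_max_induct)
  case empty
  then show ?case by simp
next
  case (insert x H)
  show ?case
  proof (cases "H = {}")
    case True
    then show ?thesis by simp
  next
    case False
    have monoH: "mono_on H A" using insert.prems by (auto simp: monotone_on_def)
    have Mx: "Max (insert x H) = x"
      using insert.hyps by (intro Max_eqI) (auto intro: less_imp_le)
    have MH: "Max H \<in> H" using False insert.hyps by simp
    have mn: "Min (insert x H) = Min H"
    proof -
      have "Min H \<le> Max H" using MH insert.hyps by simp
      moreover have "Max H < x" using MH insert.hyps by blast
      ultimately have "Min H \<le> x" by simp
      then show ?thesis using insert.hyps False by simp
    qed
    have xH: "x \<notin> H" using insert.hyps by blast
    consider (gap) "A (Max H) + d < A x" | (near) "A x \<le> A (Max H) + d" by linarith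
    then show ?thesis
    proof cases
      case gap
      have "A i + d < A x" if "i \<in> H" for i
      proof -
        have "A i \<le> A (Max H)"
          using monoH that MH insert.hyps by (auto simp: monotone_on_def)
        then show ?thesis using gap by linarith
      qed
      then have "{i \<in> insert x H. i < x} \<noteq> {} \<and> {i \<in> insert x H. x \<le> i} \<noteq> {} \<and>
            (\<forall>i\<in>insert x H. \<forall>j\<in>insert x H. i < x \<longrightarrow> x \<le> j \<longrightarrow> A i + d < A j)"
        using insert.hyps MH by fastforce
      then show ?thesis by blast
    next
      case near
      from insert.IH[OF False insert.prems(2) monoH] show ?thesis
      proof
        assume "A (Max H) - A (Min H) \<le> (real (card H) - 1) * d"
        then have "A x - A (Min H) \<le> (real (card (insert x H)) - 1) * d"
          using near xH insert.hyps by (simp add: algebra_simps)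
        then show ?thesis unfolding Mx mn by blast
      next
        assume "\<exists>c. {i \<in> H. i < c} \<noteq> {} \<and> {i \<in> H. c \<le> i} \<noteq> {} \<and>
            (\<forall>i\<in>H. \<forall>j\<in>H. i < c \<longrightarrow> c \<le> j \<longrightarrow> A i + d < A j)"
        then obtain c where c: "{i \<in> H. i < c} \<noteq> {}" "{i \<in> H. c \<le> i} \<noteq> {}"
          "\<And>i j. i \<in> H \<Longrightarrow> j \<in> H \<Longrightarrow> i < c \<Longrightarrow> c \<le> j \<Longrightarrow> A i + d < A j" by blast
        obtain j where j: "j \<in> H" "c \<le> j" using c(2) by blast
        have jx: "j < x" using j insert.hyps by blast
        \<comment> \<open>The new maximum \<open>x\<close> lands on the upper side of the old cut,
          with \<open>A x\<close> no smaller than \<open>A j\<close>, so the cut still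
          separates.\<close>
        have "A j \<le> A x" using insert.prems(3) j jx by (auto simp: monotone_on_def)
        then have "A i + d < A x" if "i \<in> H" "i < c" for i
          using c(3)[OF that(1) j(1) that(2) j(2)] by linarith
        then have "\<forall>i\<in>insert x H. \<forall>j\<in>insert x H. i < c \<longrightarrow> c \<le> j \<longrightarrow> A i + d < A j"
          using c(3) jx j by auto
        moreover have "{i \<in> insert x H. i < c} \<noteq> {}" "{i \<in> insert x H. c \<le> i} \<noteq> {}"
          using c(1,2) by auto
        ultimately show ?thesis by blast
      qed
    qed
  qed
qed

text \<open>Inclusion-exclusion for \<open>U\<close> and the preimage of \<open>V\<close>, which is
  as large as \<open>V\<close> because \<open>\<sigma>\<close> is a bijection.\<close>

lemma card_inter_vimage_ge:
  fixes \<sigma> :: "'a \<Rightarrow> 'b"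
  assumes "bij_betw \<sigma> X Y" "finite X" "U \<subseteq> X" "V \<subseteq> Y"
  shows "card U + card V \<le> card X + card {h \<in> U. \<sigma> h \<in> V}"
proof -
  let ?W = "{h \<in> X. \<sigma> h \<in> V}"
  have "bij_betw \<sigma> ?W V"
    using assms by (auto simp: bij_betw_def inj_on_def image_iff)
  then have "card ?W = card V" by (rule bij_betw_same_card)
  moreover have "finite U" "finite ?W" using assms finite_subset by auto
  then have "card U + card ?W = card (U \<union> ?W) + card (U \<inter> ?W)"
    by (rule card_Un_Int)
  moreover have "card (U \<union> ?W) \<le> card X"
    using assms by (intro card_mono) auto
  moreover have "U \<inter> ?W = {h \<in> U. \<sigma> h \<in> V}" using assms by auto
  ultimately show ?thesis by simp
qed

text \<open>The window on \<open>A h\<close> serves the induction on \<open>card H\<close>: it keeps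
  the machines found for the two sides of a gap apart, so that their numbers add up. The application
  then retains only that \<open>h\<close> lies outside \<open>Q\<close>.\<close>

lemma card_heavy_le:
  fixes A B :: "nat \<Rightarrow> real"
  assumes A: "mono_on {1..m} A" and B: "antimono_on {1..m} B"
    and \<sigma>: "bij_betw \<sigma> {1..m} {1..m}"
    and d: "0 \<le> d" "(real m - 1) * d < e"
    and Q: "\<And>i. i \<in> Q \<Longrightarrow> A i + B (\<sigma> i) \<le> L - e"
    and P: "\<And>i. i \<in> {1..m} - Q \<Longrightarrow> A i + B (\<sigma> i) \<le> L + d"
    and H: "H \<subseteq> {1..m}" "\<And>i. i \<in> H \<Longrightarrow> L \<le> A i + B i"
  shows "card H \<le> card {h \<in> {1..m} - Q. \<exists>i\<in>H. \<exists>j\<in>H. A i \<le> A h \<and> A h \<le> A j + d}"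
    (is "_ \<le> card (?S H)")
  using H
proof (induction "card H" arbitrary: H rule: less_induct)
  case less
  have fin: "finite H" using less.prems finite_subset by blast
  have finS: "finite (?S K)" for K by auto
  show ?case
  proof (cases "H = {}")
    case False
    have monoH: "mono_on H A" using A less.prems(1) by (auto simp: monotone_on_def subset_iff)
    from split_or_bounded_range[OF fin False d(1) monoH] show ?thesis
    proof
      assume "\<exists>c. {i \<in> H. i < c} \<noteq> {} \<and> {i \<in> H. c \<le> i} \<noteq> {} \<and>
            (\<forall>i\<in>H. \<forall>j\<in>H. i < c \<longrightarrow> c \<le> j \<longrightarrow> A i + d < A j)"
      then obtain c where c: "{i \<in> H. i < c} \<noteq> {}" "{i \<in> H. c \<le> i} \<noteq> {}"
          "\<And>i j. i \<in> H \<Longrightarrow> j \<in> H \<Longrightarrow> i < c \<Longrightarrow> c \<le> j \<Longrightarrow> A i + d < A j" by blast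
      define H1 H2 where "H1 = {i \<in> H. i < c}" and "H2 = {i \<in> H. c \<le> i}"
      have un: "H = H1 \<union> H2" "H1 \<inter> H2 = {}" by (auto simp: H1_def H2_def)
      have cs: "card H = card H1 + card H2" using un fin by (metis card_Un_disjoint finite_Un)
      have "card H1 > 0" "card H2 > 0" using c(1,2) fin by (auto simp: H1_def H2_def card_gt_0_iff)
      then have "card H1 < card H" "card H2 < card H" using cs by auto
      then have IH: "card K \<le> card (?S K)" if "K = H1 \<or> K = H2" for K
        using that less.prems un by (intro less.hyps) blast+
      \<comment> \<open>A value \<open>A h\<close> from the window of \<open>H1\<close> is at most
        \<open>A j + d\<close> for some \<open>j\<close> in \<open>H1\<close>, hence below
        \<open>A\<close> on all of \<open>H2\<close>.\<close>
      have "?S H1 \<inter> ?S H2 = {}"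
        using c(3) by (fastforce simp: H1_def H2_def)
      then have "card (?S H1 \<union> ?S H2) = card (?S H1) + card (?S H2)"
        using finS by (intro card_Un_disjoint) auto
      moreover have "card (?S H1 \<union> ?S H2) \<le> card (?S H)"
        using un by (intro card_mono finS) blast
      ultimately show ?thesis using cs IH[OF disjI1[OF refl]] IH[OF disjI2[OF refl]] by linarith
    next
      assume range: "A (Max H) - A (Min H) \<le> (real (card H) - 1) * d"
      define lo hi where "lo = Min H" and "hi = Max H"
      have mem: "lo \<in> H" "hi \<in> H" using fin False by (auto simp: lo_def hi_def)
      have b: "lo \<in> {1..m}" "hi \<in> {1..m}" using mem less.prems(1) by auto
      have sub: "H \<subseteq> {lo..hi}" using fin by (auto simp: lo_def hi_def)
      then have cH: "card H \<le> Suc hi - lo" using card_mono[OF _ sub] by simp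
      have "card H \<le> m" using card_mono[OF _ less.prems(1)] by simp
      then have "(real (card H) - 1) * d \<le> (real m - 1) * d"
        using d(1) by (intro mult_right_mono) auto
      then have small: "A hi - A lo < e" using range d(2) by (simp add: lo_def hi_def)
      let ?M = "{h \<in> {lo..m}. \<sigma> h \<in> {1..hi}}"
      \<comment> \<open>The long rank 1 jobs and the long rank 2 jobs outnumber the machines, so some meet.\<close>
      have "card {lo..m} + card {1..hi} \<le> card {1..m} + card ?M"
        using b by (intro card_inter_vimage_ge[OF \<sigma>]) auto
      then have "card H \<le> card ?M" using cH b by simp
      also have "?M \<subseteq> ?S H"
      proof
        fix h assume h: "h \<in> ?M"
        then have hm: "h \<in> {1..m}" "\<sigma> h \<in> {1..m}" using b by auto
        have Ah: "A lo \<le> A h" using A h b hm by (auto simp: monotone_on_def)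
        have Bh: "B hi \<le> B (\<sigma> h)" using B h b hm by (auto simp: monotone_on_def)
        have Lh: "L \<le> A hi + B hi" using less.prems(2) mem by blast
        \<comment> \<open>If \<open>h\<close> were in \<open>Q\<close>, then \<open>L - e\<close>
          would be at least \<open>A lo + B hi\<close>, which is at least
          \<open>L - (A hi - A lo)\<close> and so exceeds \<open>L - e\<close>.\<close>
        have nQ: "h \<notin> Q" using Q[of h] Ah Bh Lh small by fastforce
        then have "A h \<le> A hi + d" using P[of h] Bh Lh hm by fastforce
        then show "h \<in> ?S H" using nQ hm Ah mem by blast
      qed
      then have "card ?M \<le> card (?S H)" by (rule card_mono[OF finS])
      finally show ?thesis .
    qed
  qed simp
qed

text \<open>\<open>A i\<close> and \<open>B i\<close> stand for the rank 1 and rank 2 jobs of an LD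
  machine, which pairs ascending with descending lengths; \<open>A i\<close>,
  \<open>B (\<sigma> i)\<close>, \<open>C i\<close> stand for the optimal machine with the same rank
  1 job. The LD rule for rank 3 enters only through \<open>cnt\<close>.\<close>

lemma three_rank_bound:
  fixes A B C :: "nat \<Rightarrow> real"
  assumes m: "1 \<le> m"
    and A: "mono_on {1..m} A" and B: "antimono_on {1..m} B"
    and \<sigma>: "bij_betw \<sigma> {1..m} {1..m}"
    and BA: "\<And>i j. i \<in> {1..m} \<Longrightarrow> j \<in> {1..m} \<Longrightarrow> B j \<le> A i"
    and zB: "\<And>j. j \<in> {1..m} \<Longrightarrow> z \<le> B j" and z: "0 \<le> z"
    and C: "\<And>i. i \<in> {1..m} \<Longrightarrow> 0 \<le> C i"
    and T: "\<And>i. i \<in> {1..m} \<Longrightarrow> A i + B (\<sigma> i) + C i \<le> T"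
    and cnt: "m < card {i \<in> {1..m}. L \<le> A i + B i} + card {i \<in> {1..m}. z \<le> C i}"
  shows "L + z \<le> (5 * real m - 2) / (4 * real m - 1) * T"
proof -
  define H Q where "H = {i \<in> {1..m}. L \<le> A i + B i}" and "Q = {i \<in> {1..m}. z \<le> C i}"
  define e where "e = L + z - T"
  have fin: "finite H" "finite Q" by (auto simp: H_def Q_def)
  have sm: "\<sigma> i \<in> {1..m}" if "i \<in> {1..m}" for i using \<sigma> that by (auto simp: bij_betw_def)
  have main: "(4 * real m - 1) * e \<le> (real m - 1) * T"
  proof (cases "e \<le> 0")
    case True
    have "1 \<in> {1..m}" using m by auto
    then have "0 \<le> T" using T[of 1] BA[of 1 1] zB[of 1] zB[OF sm[of 1]] C[of 1] z by linarith
    then have "0 \<le> (real m - 1) * T" using m by simp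
    moreover have "(4 * real m - 1) * e \<le> 0" using m True by (intro mult_nonneg_nonpos) auto
    ultimately show ?thesis by linarith
  next
    case False
    have "card (H \<union> Q) \<le> card {1..m}" by (intro card_mono) (auto simp: H_def Q_def)
    then have "H \<inter> Q \<noteq> {}"
      using cnt card_Un_Int[OF fin] unfolding H_def[symmetric] Q_def[symmetric] by auto
    then obtain i where i: "i \<in> {1..m}" "L \<le> A i + B i" "z \<le> C i" by (auto simp: H_def Q_def)
    \<comment> \<open>Comparing the two loads of \<open>i\<close> gives
      \<open>B i - B (\<sigma> i) \<ge> e\<close>, so \<open>A i \<ge> B i \<ge> z + e\<close>,
      while \<open>B (\<sigma> i)\<close> and \<open>C i\<close> are each at least
      \<open>z\<close>.\<close>
    have T3: "3 * z + e \<le> T"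
      using i T[OF i(1)] BA[OF i(1,1)] zB[OF sm[OF i(1)]] unfolding e_def by linarith
    \<comment> \<open>The truncation provides \<open>0 \<le> d\<close> before \<open>L < T\<close>
      is known. Once \<open>ed\<close> is proved, \<open>e > 0\<close> forces \<open>d\<close> to be
      positive and the maximum disappears.\<close>
    define d where "d = max 0 (T - L)"
    have ed: "e \<le> (real m - 1) * d"
    proof (rule ccontr)
      assume "\<not> ?thesis"
      then have de: "(real m - 1) * d < e" by simp
      have "card H \<le> card {h \<in> {1..m} - Q. \<exists>i\<in>H. \<exists>j\<in>H. A i \<le> A h \<and> A h \<le> A j + d}"
      proof (rule card_heavy_le[OF A B \<sigma> _ de])
        show "A i + B (\<sigma> i) \<le> L - e" if "i \<in> Q" for i
          using that T[of i] by (auto simp: Q_def e_def)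
        show "A i + B (\<sigma> i) \<le> L + d" if "i \<in> {1..m} - Q" for i
          using that T[of i] C[of i] by (auto simp: d_def)
      qed (auto simp: H_def d_def)
      also have "\<dots> \<le> card ({1..m} - Q)" by (intro card_mono) auto
      also have "\<dots> = m - card Q" by (subst card_Diff_subset) (auto simp: Q_def)
      finally have "card H \<le> m - card Q" .
      moreover have "card Q \<le> m"
        using card_mono[of "{1..m}" Q] unfolding Q_def by (simp add: subset_iff)
      ultimately show False using cnt unfolding H_def[symmetric] Q_def[symmetric] by linarith
    qed
    have "d = T - L"
      using ed False by (auto simp: d_def max_def split: if_splits)
    then have "4 * e + 3 * d \<le> T" using T3 by (simp add: e_def)
    \<comment> \<open>By \<open>ed\<close>, the term \<open>3 * (m - 1) * d\<close> is at least
      \<open>3 * e\<close>, which raises the coefficient of \<open>e\<close> from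
      \<open>4 * m - 4\<close> to \<open>4 * m - 1\<close>.\<close>
    then have "(real m - 1) * (4 * e + 3 * d) \<le> (real m - 1) * T"
      using m by (intro mult_left_mono) auto
    then show ?thesis using ed by (simp add: algebra_simps)
  qed
  have "(4 * real m - 1) * (L + z) \<le> (5 * real m - 2) * T"
    using main by (simp add: e_def algebra_simps)
  then show ?thesis using m by (simp add: field_simps)
qed

section \<open>Jobs, loads and completion times in schedules with one job per rank on each
  machine\<close>

lemma fm_rank_subset: "r \<le> k \<Longrightarrow> fm_rank m r \<subseteq> {1..m * k}"
  using mult_le_mono2[of r k m] by (auto simp: fm_rank_def mult.commute)

lemma flowtime_optimal_bij_betw_rank:
  assumes "flowtime_optimal m k a" "r \<in> {1..k}"
  shows "bij_betw a (fm_rank m r) {1..m}"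
proof -
  have sub: "fm_rank m r \<subseteq> {1..m * k}"
    using assms(2) by (intro fm_rank_subset) simp
  have "a ` fm_rank m r \<subseteq> {1..m}"
    using assms(1) sub by (auto simp: flowtime_optimal_def PiE_def Pi_def)
  moreover have ex1: "\<exists>!j. j \<in> fm_rank m r \<and> a j = i" if "i \<in> {1..m}" for i
    using assms that unfolding flowtime_optimal_def by blast
  ultimately show ?thesis
    unfolding bij_betw_def inj_on_def
    by (intro conjI ballI impI equalityI subsetI) (blast, blast, metis imageI ex1)
qed

lemma sum_rank_machine:
  assumes "bij_betw a (fm_rank m r) {1..m}" "i \<in> {1..m}"
  shows "(\<Sum>j\<in>{j \<in> fm_rank m r. a j = i}. p j) = p (inv_into (fm_rank m r) a i)"
proof -
  have "{j \<in> fm_rank m r. a j = i} = {inv_into (fm_rank m r) a i}"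
    using assms by (auto simp: bij_betw_def inv_into_into f_inv_into_f)
  then show ?thesis by simp
qed

lemma fm_instance_rank_le:
  assumes "fm_instance m k p" "1 \<le> r" "r < s" "s \<le> k" "i \<in> fm_rank m r" "j \<in> fm_rank m s"
  shows "p j \<le> p i"
proof -
  have mem: "i \<in> {1..m * k}" "j \<in> {1..m * k}"
    using fm_rank_subset[of r k m] fm_rank_subset[of s k m] assms by auto
  have "r * m \<le> (s - 1) * m" using assms(3) by (intro mult_le_mono1) auto
  moreover have "i \<le> r * m" "(s - 1) * m \<le> j" using assms(5,6) by (auto simp: fm_rank_def)
  ultimately have "i \<le> j" by linarith
  then show ?thesis using assms(1) mem by (auto simp: fm_instance_def monotone_on_def)
qed

lemma fm_completion_three:
  assumes "flowtime_optimal m 3 a" "i \<in> {1..m}"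
  shows "fm_completion m 3 p a i 1 = p (inv_into (fm_rank m 1) a i)
    + p (inv_into (fm_rank m 2) a i) + p (inv_into (fm_rank m 3) a i)"
proof -
  have "{1..3::nat} = {1, 2, 3}" by auto
  then show ?thesis
    using assms flowtime_optimal_bij_betw_rank[OF assms(1)]
    by (simp add: fm_completion_def sum_rank_machine)
qed

lemma fm_load_one:
  assumes "bij_betw a (fm_rank m 1) {1..m}" "i \<in> {1..m}"
  shows "fm_load m p a 1 i = p (inv_into (fm_rank m 1) a i)"
  using sum_rank_machine[OF assms, of p] by (simp add: fm_load_def fm_rank_def)

lemma fm_load_two:
  assumes "bij_betw a (fm_rank m 1) {1..m}" "bij_betw a (fm_rank m 2) {1..m}" "i \<in> {1..m}"
  shows "fm_load m p a 2 i = p (inv_into (fm_rank m 1) a i) + p (inv_into (fm_rank m 2) a i)"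
proof -
  have "{j \<in> {1..2 * m}. a j = i} = {j \<in> fm_rank m 1. a j = i} \<union> {j \<in> fm_rank m 2. a j = i}"
    by (auto simp: fm_rank_def)
  moreover have "{j \<in> fm_rank m 1. a j = i} \<inter> {j \<in> fm_rank m 2. a j = i} = {}"
    by (auto simp: fm_rank_def)
  ultimately have "fm_load m p a 2 i = (\<Sum>j\<in>{j \<in> fm_rank m 1. a j = i}. p j)
      + (\<Sum>j\<in>{j \<in> fm_rank m 2. a j = i}. p j)"
    unfolding fm_load_def by (subst sum.union_disjoint[symmetric]) (auto simp: fm_rank_def)
  then show ?thesis using assms by (simp add: sum_rank_machine)
qed

text \<open>Rank 1 is processed last, and lengths are nonnegative, so the maximum is attained
  there.\<close>

lemma machine_completion_eq:
  assumes "fm_instance m k p"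
  shows "machine_completion m k p a i = fm_completion m k p a i 1"
  unfolding machine_completion_def
proof (rule Max_eqI)
  have nn: "0 \<le> (\<Sum>j\<in>{j \<in> fm_rank m s. a j = i}. p j)" if "s \<in> {1..k}" for s
    using assms that fm_rank_subset[of s k m]
    by (intro sum_nonneg) (auto simp: fm_instance_def)
  show "y \<le> fm_completion m k p a i 1" if y: "y \<in> fm_completion m k p a i ` {1..k}" for y
  proof -
    obtain r where r: "r \<in> {1..k}" "y = fm_completion m k p a i r" using y by blast
    show ?thesis unfolding r(2) fm_completion_def
      using r nn by (intro sum_mono2) auto
  qed
qed (use assms in \<open>auto simp: fm_instance_def\<close>)

section \<open>Transfer to LD schedules\<close>

text \<open>Here \<open>q\<close> is any flowtime-optimal schedule and \<open>T\<close> any bound on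
  its completion times; the theorem takes a \<open>q\<close> that attains
  \<open>t_star\<close>.\<close>

lemma LD_machine_bound:
  assumes inst: "fm_instance m 3 p" and LD: "LD_schedule m 3 p a"
    and opt: "flowtime_optimal m 3 q"
    and T: "\<And>i. i \<in> {1..m} \<Longrightarrow> fm_completion m 3 p q i 1 \<le> T"
    and i0: "i0 \<in> {1..m}"
  shows "fm_completion m 3 p a i0 1 \<le> (5 * real m - 2) / (4 * real m - 1) * T"
proof -
  have m: "1 \<le> m" using i0 by auto
  have fa: "flowtime_optimal m 3 a" using LD by (rule LD_schedule_flowtime_optimal)
  define U V where "U s = inv_into (fm_rank m s) a" and "V s = inv_into (fm_rank m s) q" for s
  have ba: "bij_betw a (fm_rank m s) {1..m}" and bq: "bij_betw q (fm_rank m s) {1..m}"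
    if "s \<in> {1..3}" for s
    using flowtime_optimal_bij_betw_rank fa opt that by blast+
  have bU: "bij_betw (U s) {1..m} (fm_rank m s)" and bV: "bij_betw (V s) {1..m} (fm_rank m s)"
    if "s \<in> {1..3}" for s
    unfolding U_def V_def using bij_betw_inv_into ba[OF that] bq[OF that] by blast+
  have Ua: "U s (a j) = j" and Vq: "V s (q j) = j" if "s \<in> {1..3}" "j \<in> fm_rank m s" for s j
    using ba[OF that(1)] bq[OF that(1)] that(2) by (auto simp: U_def V_def bij_betw_def)
  obtain \<tau>2 \<sigma>2 where 2: "bij_betw \<tau>2 {1..m} (fm_rank m 2)" "antimono_on {1..m} (\<lambda>l. p (\<tau>2 l))"
      "bij_betw \<sigma>2 {1..m} {1..m}" "mono_on {1..m} (\<lambda>l. fm_load m p a 1 (\<sigma>2 l))"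
      "\<And>l. l \<in> {1..m} \<Longrightarrow> a (\<tau>2 l) = \<sigma>2 l"
  proof -
    have "2 \<in> {1..3::nat}" "2 - 1 = (1::nat)" by auto
    then show ?thesis using LD that unfolding LD_schedule_def by metis
  qed
  obtain \<tau>3 \<sigma>3 where 3: "bij_betw \<tau>3 {1..m} (fm_rank m 3)" "antimono_on {1..m} (\<lambda>l. p (\<tau>3 l))"
      "bij_betw \<sigma>3 {1..m} {1..m}" "mono_on {1..m} (\<lambda>l. fm_load m p a 2 (\<sigma>3 l))"
      "\<And>l. l \<in> {1..m} \<Longrightarrow> a (\<tau>3 l) = \<sigma>3 l"
  proof -
    have "3 \<in> {1..3::nat}" "3 - 1 = (2::nat)" by auto
    then show ?thesis using LD that unfolding LD_schedule_def by metis
  qed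
  \<comment> \<open>Everything is indexed by the position \<open>l\<close> in the LD order for rank
    2. \<open>\<alpha> l\<close> is the rank 1 job of LD machine \<open>\<sigma>2 l\<close>, and
    \<open>\<mu> l\<close> is the machine of \<open>q\<close> holding that job; its rank 2 job has
    position \<open>\<pi> l\<close> in \<open>\<tau>2\<close>, and its rank 3 job is
    \<open>\<gamma> l\<close>.\<close>
  define \<alpha> where "\<alpha> = U 1 \<circ> \<sigma>2"
  define \<mu> where "\<mu> = q \<circ> \<alpha>"
  define \<pi> where "\<pi> = inv_into {1..m} \<tau>2 \<circ> (V 2 \<circ> \<mu>)"
  define \<gamma> where "\<gamma> = V 3 \<circ> \<mu>"
  have b\<alpha>: "bij_betw \<alpha> {1..m} (fm_rank m 1)"
    unfolding \<alpha>_def by (rule bij_betw_trans[OF 2(3)]) (rule bU, simp)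
  have b\<mu>: "bij_betw \<mu> {1..m} {1..m}"
    unfolding \<mu>_def by (rule bij_betw_trans[OF b\<alpha>]) (rule bq, simp)
  have bV\<mu>: "bij_betw (V 2 \<circ> \<mu>) {1..m} (fm_rank m 2)"
    by (rule bij_betw_trans[OF b\<mu>]) (rule bV, simp)
  have b\<pi>: "bij_betw \<pi> {1..m} {1..m}"
    unfolding \<pi>_def by (rule bij_betw_trans[OF bV\<mu>]) (rule bij_betw_inv_into[OF 2(1)])
  have b\<gamma>: "bij_betw \<gamma> {1..m} (fm_rank m 3)"
    unfolding \<gamma>_def by (rule bij_betw_trans[OF b\<mu>]) (rule bV, simp)
  have \<alpha>r: "\<alpha> l \<in> fm_rank m 1" and \<mu>r: "\<mu> l \<in> {1..m}" and \<gamma>r: "\<gamma> l \<in> fm_rank m 3"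
    and \<tau>2r: "\<tau>2 l \<in> fm_rank m 2" and \<tau>3r: "\<tau>3 l \<in> fm_rank m 3"
    and \<sigma>2r: "\<sigma>2 l \<in> {1..m}" and \<sigma>3r: "\<sigma>3 l \<in> {1..m}"
    if "l \<in> {1..m}" for l
    using that b\<alpha> b\<mu> b\<gamma> 2(1,3) 3(1,3) bij_betwE by blast+
  have \<tau>\<pi>: "\<tau>2 (\<pi> l) = V 2 (\<mu> l)" if "l \<in> {1..m}" for l
    using that bV\<mu> 2(1) by (auto simp: \<pi>_def bij_betw_def intro!: f_inv_into_f)
  have load1: "fm_load m p a 1 (\<sigma>2 l) = p (\<alpha> l)" if "l \<in> {1..m}" for l
    using fm_load_one[OF ba[of 1] \<sigma>2r[OF that]] by (simp add: \<alpha>_def U_def)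
  have load2: "fm_load m p a 2 (\<sigma>2 l) = p (\<alpha> l) + p (\<tau>2 l)" if "l \<in> {1..m}" for l
    using fm_load_two[OF ba[of 1] ba[of 2] \<sigma>2r[OF that]] Ua[of 2 "\<tau>2 l"] 2(5)[OF that] \<tau>2r[OF that]
    by (simp add: \<alpha>_def U_def)
  obtain l0 where l0: "l0 \<in> {1..m}" "\<sigma>3 l0 = i0"
    using 3(3) i0 unfolding bij_betw_def by (metis imageE)
  define L z where "L = fm_load m p a 2 i0" and "z = p (\<tau>3 l0)"
  have "fm_completion m 3 p a i0 1 = L + z"
    using fm_completion_three[OF fa i0] fm_load_two[OF ba[of 1] ba[of 2] i0]
      Ua[of 3 "\<tau>3 l0"] 3(5)[OF l0(1)] \<tau>3r[OF l0(1)] l0(2)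
    by (simp add: L_def z_def U_def)
  moreover have "L + z \<le> (5 * real m - 2) / (4 * real m - 1) * T"
  proof (rule three_rank_bound[OF m])
    show "mono_on {1..m} (\<lambda>l. p (\<alpha> l))"
      using 2(4) load1 by (auto simp: monotone_on_def)
    show "antimono_on {1..m} (\<lambda>l. p (\<tau>2 l))" by (rule 2(2))
    show "bij_betw \<pi> {1..m} {1..m}" by (rule b\<pi>)
    show "p (\<tau>2 j) \<le> p (\<alpha> i)" if "i \<in> {1..m}" "j \<in> {1..m}" for i j
      using fm_instance_rank_le[OF inst _ _ _ \<alpha>r[OF that(1)] \<tau>2r[OF that(2)]] by simp
    show "z \<le> p (\<tau>2 j)" if "j \<in> {1..m}" for j
      unfolding z_def
      using fm_instance_rank_le[OF inst _ _ _ \<tau>2r[OF that] \<tau>3r[OF l0(1)]] by simp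
    have nn: "0 \<le> p j" if "j \<in> fm_rank m 3" for j
      using inst that fm_rank_subset[of 3 3 m] by (auto simp: fm_instance_def)
    show "0 \<le> z" unfolding z_def by (rule nn[OF \<tau>3r[OF l0(1)]])
    show "0 \<le> p (\<gamma> i)" if "i \<in> {1..m}" for i by (rule nn[OF \<gamma>r[OF that]])
    show "p (\<alpha> i) + p (\<tau>2 (\<pi> i)) + p (\<gamma> i) \<le> T" if "i \<in> {1..m}" for i
      using T[OF \<mu>r[OF that]] fm_completion_three[OF opt \<mu>r[OF that], of p]
        \<tau>\<pi>[OF that] Vq[of 1 "\<alpha> i"] \<alpha>r[OF that]
      by (simp add: V_def \<mu>_def \<gamma>_def)
    let ?H = "{i \<in> {1..m}. L \<le> p (\<alpha> i) + p (\<tau>2 i)}" and ?Q = "{i \<in> {1..m}. z \<le> p (\<gamma> i)}"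
    \<comment> \<open>In the rank 3 order, machines from position \<open>l0\<close> on have load at
      least \<open>L\<close>, and jobs up to position \<open>l0\<close> have length at least
      \<open>z\<close>. Position \<open>l0\<close> counts on both sides, so the total is at least
      \<open>m + 1\<close>.\<close>
    have "\<sigma>3 ` {l0..m} \<subseteq> \<sigma>2 ` ?H"
    proof
      fix x assume "x \<in> \<sigma>3 ` {l0..m}"
      then obtain l where l: "l \<in> {l0..m}" "x = \<sigma>3 l" by blast
      have lm: "l \<in> {1..m}" using l l0 by auto
      have "x \<in> {1..m}" using l \<sigma>3r lm by blast
      then obtain i where i: "i \<in> {1..m}" "\<sigma>2 i = x"
        using 2(3) unfolding bij_betw_def by (metis imageE)
      have "L \<le> fm_load m p a 2 x"
        using 3(4) l lm l0 by (auto simp: L_def monotone_on_def)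
      then show "x \<in> \<sigma>2 ` ?H" using load2 i by auto
    qed
    then have "card (\<sigma>3 ` {l0..m}) \<le> card ?H"
      by (intro surj_card_le) auto
    moreover have "card (\<sigma>3 ` {l0..m}) = m + 1 - l0"
      using 3(3) l0 by (subst card_image) (auto simp: bij_betw_def intro: inj_on_subset)
    moreover have "\<tau>3 ` {1..l0} \<subseteq> \<gamma> ` ?Q"
    proof
      fix x assume "x \<in> \<tau>3 ` {1..l0}"
      then obtain l where l: "l \<in> {1..l0}" "x = \<tau>3 l" by blast
      have lm: "l \<in> {1..m}" using l l0 by auto
      have "x \<in> fm_rank m 3" using l \<tau>3r lm by blast
      then obtain i where i: "i \<in> {1..m}" "\<gamma> i = x"
        using b\<gamma> unfolding bij_betw_def by (metis imageE)
      have "z \<le> p x"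
        using 3(2) l lm l0 by (auto simp: z_def monotone_on_def)
      then show "x \<in> \<gamma> ` ?Q" using i by auto
    qed
    then have "card (\<tau>3 ` {1..l0}) \<le> card ?Q"
      by (intro surj_card_le) auto
    moreover have "card (\<tau>3 ` {1..l0}) = l0"
      using 3(1) l0 by (subst card_image) (auto simp: bij_betw_def intro: inj_on_subset)
    ultimately show "m < card ?H + card ?Q" using l0 by auto
  qed
  ultimately show ?thesis by simp
qed

theorem theorem7p14:
  fixes m :: nat and p :: "nat \<Rightarrow> real" and a :: "nat \<Rightarrow> nat"
  assumes "m \<ge> 1"
    and "fm_instance m 3 p"
    and "LD_schedule m 3 p a"
  shows "makespan m 3 p a \<le> (5 * real m - 2) / (4 * real m - 1) * t_star m 3 p"
proof -
  obtain q where q: "flowtime_optimal m 3 q" "t_star m 3 p = makespan m 3 p q"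
    using t_star_attained by blast
  have "fm_completion m 3 p q i 1 \<le> t_star m 3 p" if "i \<in> {1..m}" for i
    unfolding q(2) makespan_def machine_completion_eq[OF assms(2), symmetric]
    using that by (intro Max_ge) auto
  then have "machine_completion m 3 p a i \<le> (5 * real m - 2) / (4 * real m - 1) * t_star m 3 p"
    if "i \<in> {1..m}" for i
    unfolding machine_completion_eq[OF assms(2)]
    using LD_machine_bound[OF assms(2,3) q(1)] that by blast
  then show ?thesis
    unfolding makespan_def using assms(1) by (subst Max_le_iff) auto
qed

end
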